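(* Let $M^{\mathrm{tax}}_\Lambda\ge0$ be the pressure/tax detector on a class $\mathcal A^{\mathrm{tax}}_\Lambda$ of packages, with admissible gauge class $\Gamma=\Gamma^{\mathrm{int}}_{\Lambda,\mathrm{adm}}$ and baseline quotient distance $\operatorname{dist}_{\mathrm{loc},\mathrm{int},0}(\cdot,\Gamma)$. Assume: (i) the class is stable under quotient normalization: if $r=\operatorname{dist}_{\mathrm{loc},\mathrm{int},0}(D,\Gamma)>0$, then a normalized representative $D/r$ belongs to the class and has distance $1$; (ii) the unit quotient sphere $S_{\Lambda,0}:=\{D\in\mathcal A^{\mathrm{tax}}_\Lambda:\operatorname{dist}_{\mathrm{loc},\mathrm{int},0}(D,\Gamma)=1\}$ is compact modulo gauge; (iii) $M^{\mathrm{tax}}_\Lambda$ is lower semicontinuous on this quotient; (iv) $M^{\mathrm{tax}}_\Lambda$ is positively homogeneous under the quotient normalization; (v) kernel-freeness: $\mathcal K^{\mathrm{tax}}_\Lambda:=\{D\in\mathcal A^{\mathrm{tax}}_\Lambda:M^{\mathrm{tax}}_\Lambda(D)=0\}\subset\Gamma$. Then $$\mu^{\mathrm{tax}}_\Lambda:=\inf_{D\in S_{\Lambda,0}}M^{\mathrm{tax}}_\Lambda(D)>0,$$ and for every $D\in\mathcal A^{\mathrm{tax}}_\Lambda$, $$M^{\mathrm{tax}}_\Lambda(D)\ge\mu^{\mathrm{tax}}_\Lambda\operatorname{dist}_{\mathrm{loc},\mathrm{int},0}(D,\Gamma).$$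
   Context: Packages live in a real topological vector space containing $\mathcal A^{\mathrm{tax}}_\Lambda$ and the gauge subspace $\Gamma$; $\operatorname{dist}_{\mathrm{loc},\mathrm{int},0}(D,\Gamma)=\inf_{\zeta\in\Gamma}\|D-\zeta\|_{\mathrm{loc},\mathrm{int},0}$ for a given baseline norm. "Modulo gauge" and "on this quotient" refer to the quotient by $\Gamma$: the image of $S_{\Lambda,0}$ in the quotient is compact, and $M^{\mathrm{tax}}_\Lambda$, regarded as a function on that quotient, is lower semicontinuous there. Positive homogeneity under normalization: $M^{\mathrm{tax}}_\Lambda(D)=r\,M^{\mathrm{tax}}_\Lambda(D/r)$ for $r=\operatorname{dist}_{\mathrm{loc},\mathrm{int},0}(D,\Gamma)>0$. The detector is $$M^{\mathrm{tax}}_\Lambda(D)=\|O^0_\Lambda D\|_{\mathcal O}+\beta_{\mathrm{prs}}\mathsf{Tax}_{\mathrm{prs}}(D)+\beta_{\mathrm{loc}}\mathsf{Tax}_{\mathrm{loc}}(D)+\beta_{\mathrm{rep}}\mathsf{Tax}_{\mathrm{rep}}(D)+\beta_{\mathrm{gs}}\mathsf{Tax}_{\mathrm{gs}}(D)+\beta_{\mathrm{det}}\mathsf{Tax}_{\mathrm{det}}(D)$$ with an observable $O^0_\Lambda$, nonnegative tax functionals and positive weights. Convention: $\inf\emptyset=+\infty$ and $(+\infty)\cdot0=0$. *)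

theory Defs
  imports "HOL-Analysis.Analysis"
begin

text \<open>The baseline norm is an arbitrary norm on the ambient space, given as a function: it is
  independent of the topology that the type class provides.\<close>

definition is_norm :: "('v::real_vector \<Rightarrow> real) \<Rightarrow> bool" where
  "is_norm N \<longleftrightarrow>
     (\<forall>x. 0 \<le> N x) \<and> (\<forall>x. N x = 0 \<longleftrightarrow> x = 0) \<and>
     (\<forall>c x. N (c *\<^sub>R x) = \<bar>c\<bar> * N x) \<and> (\<forall>x y. N (x + y) \<le> N x + N y)"

definition gauge_dist :: "('v::real_vector \<Rightarrow> real) \<Rightarrow> 'v set \<Rightarrow> 'v \<Rightarrow> real" where
  "gauge_dist N \<Gamma> D = (INF \<zeta>\<in>\<Gamma>. N (D - \<zeta>))"

definition unit_quotient_sphere ::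
    "'v::real_vector set \<Rightarrow> ('v \<Rightarrow> real) \<Rightarrow> 'v set \<Rightarrow> 'v set" where
  "unit_quotient_sphere A N \<Gamma> = {D \<in> A. gauge_dist N \<Gamma> D = 1}"

definition gauge_class :: "'v::real_vector set \<Rightarrow> 'v \<Rightarrow> 'v set" where
  "gauge_class \<Gamma> D = (\<lambda>\<zeta>. D + \<zeta>) ` \<Gamma>"

definition gauge_quotient ::
    "'v::{real_vector, topological_space} set \<Rightarrow> 'v set topology" where
  "gauge_quotient \<Gamma> =
     topology (\<lambda>U. U \<subseteq> range (gauge_class \<Gamma>) \<and> open (gauge_class \<Gamma> -` U))"

lemma openin_gauge_quotient:
  "openin (gauge_quotient \<Gamma>) U \<longleftrightarrow>
     U \<subseteq> range (gauge_class \<Gamma>) \<and> open (gauge_class \<Gamma> -` U)"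
proof -
  have "istopology (\<lambda>U. U \<subseteq> range (gauge_class \<Gamma>) \<and> open (gauge_class \<Gamma> -` U))"
    unfolding istopology_def by (auto simp: vimage_Union)
  then show ?thesis
    by (simp add: gauge_quotient_def topology_inverse')
qed

lemma topspace_gauge_quotient: "topspace (gauge_quotient \<Gamma>) = range (gauge_class \<Gamma>)"
  unfolding topspace_def openin_gauge_quotient
  by (auto intro!: exI[of _ "range (gauge_class \<Gamma>)"] simp: vimage_def)

lemma quotient_map_gauge_class:
  "quotient_map euclidean (gauge_quotient \<Gamma>) (gauge_class \<Gamma>)"
  unfolding quotient_map_def topspace_gauge_quotient openin_gauge_quotient
  by (auto simp: vimage_def)

definition lower_semicontinuous_map :: "'a topology \<Rightarrow> ('a \<Rightarrow> ereal) \<Rightarrow> bool" where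
  "lower_semicontinuous_map X f \<longleftrightarrow> (\<forall>a. openin X {x \<in> topspace X. a < f x})"

datatype tax_kind = Prs | Loc | Rep | Gs | Det

text \<open>The tax functionals may take the value \<open>\<infinity>\<close>; finite taxes are the special case where
  they are real-valued.\<close>

definition tax_detector ::
    "('v \<Rightarrow> 'o::real_normed_vector) \<Rightarrow> (tax_kind \<Rightarrow> real) \<Rightarrow> (tax_kind \<Rightarrow> 'v \<Rightarrow> ereal) \<Rightarrow> 'v \<Rightarrow> ereal"
where
  "tax_detector Obs \<beta> Tax D =
     ereal (norm (Obs D)) + ereal (\<beta> Prs) * Tax Prs D + ereal (\<beta> Loc) * Tax Loc D
       + ereal (\<beta> Rep) * Tax Rep D + ereal (\<beta> Gs) * Tax Gs D + ereal (\<beta> Det) * Tax Det D"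

definition tax_kernel :: "'v set \<Rightarrow> ('v \<Rightarrow> ereal) \<Rightarrow> 'v set" where
  "tax_kernel A M = {D \<in> A. M D = 0}"

text \<open>In \<^typ>\<open>ereal\<close>, the infimum of the empty set is \<open>\<infinity>\<close> and \<open>\<infinity> * 0 = 0\<close>.\<close>

definition tax_gap ::
    "'v::real_vector set \<Rightarrow> ('v \<Rightarrow> real) \<Rightarrow> 'v set \<Rightarrow> ('v \<Rightarrow> ereal) \<Rightarrow> ereal" where
  "tax_gap A N \<Gamma> M = (INF D\<in>unit_quotient_sphere A N \<Gamma>. M D)"

end

theory Submission
  imports Defs
begin

text \<open>The infimum over the unit quotient sphere is attained, because a lower semicontinuous
  function on a nonempty compact set has a minimum
  (\<open>lower_semicontinuous_map_attains_inf\<close>). Compactness holds only modulo gauge, so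
  this is applied to \<open>Mq\<close> on the quotient and pulled back to \<open>M\<close>. A
  minimizer has distance 1, hence lies outside \<open>\<Gamma>\<close>
  (\<open>gauge_dist_eq_0\<close>); kernel-freeness and nonnegativity of the detector then make the
  minimum positive. Homogeneity carries the bound from the sphere to every package at positive
  distance, and at distance 0 nonnegativity suffices.\<close>

lemma lower_semicontinuous_map_attains_inf:
  assumes lsc: "lower_semicontinuous_map X f" and K: "compactin X K" and "K \<noteq> {}"
  shows "\<exists>x\<in>K. \<forall>y\<in>K. f x \<le> f y"
proof (rule ccontr)
  assume "\<not> ?thesis"
  then have below: "\<forall>x\<in>K. \<exists>y\<in>K. f y < f x"
    by (meson not_le)
  \<comment> \<open>Without a minimizer, the strict superlevel sets at the values taken on
    \<open>K\<close> form an open cover of \<open>K\<close>.\<close>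
  define V where "V y = {x \<in> topspace X. f y < f x}" for y
  have "K \<subseteq> topspace X"
    using K by (rule compactin_subset_topspace)
  with below have "K \<subseteq> \<Union> (V ` K)"
    by (fastforce simp: V_def)
  moreover have "\<And>U. U \<in> V ` K \<Longrightarrow> openin X U"
    using lsc by (auto simp: lower_semicontinuous_map_def V_def)
  ultimately obtain \<F> where "finite \<F>" "\<F> \<subseteq> V ` K" "K \<subseteq> \<Union> \<F>"
    using K unfolding compactin_def by meson
  then obtain F where F: "finite F" "F \<subseteq> K" "K \<subseteq> \<Union> (V ` F)"
    by (metis finite_subset_image)
  with \<open>K \<noteq> {}\<close> have "F \<noteq> {}"
    by auto
  \<comment> \<open>The index of least value in the finite subcover lies in \<open>K\<close> but in
    no set of that subcover.\<close>
  then obtain y where y: "y \<in> F" "\<And>z. z \<in> F \<Longrightarrow> f y \<le> f z"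
    using F(1) ex_min_if_finite[of "f ` F"] by (force simp: not_less)
  with F obtain z where "z \<in> F" "f z < f y"
    by (fastforce simp: V_def)
  with y(2) show False
    by (simp add: leD)
qed

lemma gauge_dist_nonneg:
  assumes "is_norm N" "\<Gamma> \<noteq> {}"
  shows "0 \<le> gauge_dist N \<Gamma> D"
  using assms unfolding gauge_dist_def is_norm_def by (intro cINF_greatest) auto

lemma gauge_dist_eq_0:
  assumes N: "is_norm N" and D: "D \<in> \<Gamma>"
  shows "gauge_dist N \<Gamma> D = 0"
proof (rule antisym)
  \<comment> \<open>A real infimum lies below its members only for a family bounded below; here 0 is
    a bound, and the member used is \<open>\<zeta> = D\<close>.\<close>
  have "bdd_below ((\<lambda>\<zeta>. N (D - \<zeta>)) ` \<Gamma>)"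
    using N unfolding is_norm_def by (intro bdd_belowI2[of _ 0]) auto
  then have "gauge_dist N \<Gamma> D \<le> N (D - D)"
    unfolding gauge_dist_def using D by (rule cINF_lower)
  also have "\<dots> = 0"
    using N by (simp add: is_norm_def)
  finally show "gauge_dist N \<Gamma> D \<le> 0" .
  show "0 \<le> gauge_dist N \<Gamma> D"
    using assms by (intro gauge_dist_nonneg) auto
qed

lemma tax_detector_nonneg:
  assumes "\<And>k. 0 \<le> \<beta> k" "\<And>k. 0 \<le> Tax k D"
  shows "0 \<le> tax_detector Obs \<beta> Tax D"
  unfolding tax_detector_def using assms
  by (intro add_nonneg_nonneg ereal_0_le_mult) auto

theorem theoremC65:
  fixes A \<Gamma> :: "'v::{real_vector, topological_ab_group_add} set"
    and N :: "'v \<Rightarrow> real"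
    and Obs :: "'v \<Rightarrow> 'o::real_normed_vector"
    and \<beta> :: "tax_kind \<Rightarrow> real"
    and Tax :: "tax_kind \<Rightarrow> 'v \<Rightarrow> ereal"
    and M :: "'v \<Rightarrow> ereal"
    and Mq :: "'v set \<Rightarrow> ereal"
  assumes continuous_scaleR: "continuous_on UNIV (\<lambda>(c::real, x::'v). c *\<^sub>R x)"
    and gauge_subspace: "subspace \<Gamma>"
    and baseline_norm: "is_norm N"
    and weights_pos: "\<And>k. \<beta> k > 0"
    and tax_nonneg: "\<And>k D. D \<in> A \<Longrightarrow> Tax k D \<ge> 0"
    and detector: "M = tax_detector Obs \<beta> Tax"
    and normalization: "\<And>D. D \<in> A \<Longrightarrow> gauge_dist N \<Gamma> D > 0 \<Longrightarrow>
      D /\<^sub>R gauge_dist N \<Gamma> D \<in> A \<and> gauge_dist N \<Gamma> (D /\<^sub>R gauge_dist N \<Gamma> D) = 1"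
    and compact_mod_gauge:
      "compactin (gauge_quotient \<Gamma>) (gauge_class \<Gamma> ` unit_quotient_sphere A N \<Gamma>)"
    and descends: "\<And>D. D \<in> A \<Longrightarrow> Mq (gauge_class \<Gamma> D) = M D"
    and lower_semicontinuous:
      "lower_semicontinuous_map (subtopology (gauge_quotient \<Gamma>) (gauge_class \<Gamma> ` A)) Mq"
    and homogeneous: "\<And>D. D \<in> A \<Longrightarrow> gauge_dist N \<Gamma> D > 0 \<Longrightarrow>
      M D = ereal (gauge_dist N \<Gamma> D) * M (D /\<^sub>R gauge_dist N \<Gamma> D)"
    and kernel_free: "tax_kernel A M \<subseteq> \<Gamma>"
  shows "tax_gap A N \<Gamma> M > 0 \<and>
    (\<forall>D\<in>A. M D \<ge> tax_gap A N \<Gamma> M * ereal (gauge_dist N \<Gamma> D))"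
proof -
  define S where "S = unit_quotient_sphere A N \<Gamma>"
  have S_A: "S \<subseteq> A"
    by (auto simp: S_def unit_quotient_sphere_def)
  have "\<Gamma> \<noteq> {}"
    using gauge_subspace subspace_0 by blast
  then have dist_nonneg: "0 \<le> gauge_dist N \<Gamma> D" for D
    by (rule gauge_dist_nonneg[OF baseline_norm])
  have M_nonneg: "0 \<le> M D" if "D \<in> A" for D
    unfolding detector using weights_pos tax_nonneg that
    by (intro tax_detector_nonneg) (auto simp: less_imp_le)
  have M_pos: "0 < M D" if "D \<in> S" for D
  proof -
    have "D \<in> A" "gauge_dist N \<Gamma> D = 1"
      using that by (auto simp: S_def unit_quotient_sphere_def)
    then have "D \<notin> \<Gamma>"
      using gauge_dist_eq_0[OF baseline_norm] by force
    then have "M D \<noteq> 0"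
      using kernel_free \<open>D \<in> A\<close> by (auto simp: tax_kernel_def)
    with M_nonneg[OF \<open>D \<in> A\<close>] show ?thesis
      by simp
  qed
  have gap_pos: "0 < tax_gap A N \<Gamma> M"
  proof (cases "S = {}")
    \<comment> \<open>Over an empty sphere the infimum is \<infinity>, which is positive.\<close>
    case True
    then show ?thesis
      by (simp add: tax_gap_def S_def top_ereal_def)
  next
    case False
    \<comment> \<open>Semicontinuity is given only on the image of \<open>A\<close>, so compactness
      is first moved to that subspace.\<close>
    have "compactin (subtopology (gauge_quotient \<Gamma>) (gauge_class \<Gamma> ` A)) (gauge_class \<Gamma> ` S)"
      using compact_mod_gauge S_A by (auto simp: compactin_subtopology S_def)
    from lower_semicontinuous_map_attains_inf[OF lower_semicontinuous this] False
    obtain D where D: "D \<in> S" "\<forall>E\<in>S. Mq (gauge_class \<Gamma> D) \<le> Mq (gauge_class \<Gamma> E)"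
      by auto
    then have "\<forall>E\<in>S. M D \<le> M E"
      using descends S_A by (metis subsetD)
    then have "M D \<le> tax_gap A N \<Gamma> M"
      unfolding tax_gap_def S_def by (intro INF_greatest) auto
    with M_pos[OF D(1)] show ?thesis
      by (rule less_le_trans)
  qed
  have "tax_gap A N \<Gamma> M * ereal (gauge_dist N \<Gamma> D) \<le> M D" if D: "D \<in> A" for D
  proof (cases "gauge_dist N \<Gamma> D = 0")
    \<comment> \<open>The product is 0 here even for an infinite gap, since \<infinity> * 0 =
      0.\<close>
    case True
    with M_nonneg[OF D] show ?thesis
      by (simp flip: zero_ereal_def)
  next
    case False
    with dist_nonneg[of D] have r: "gauge_dist N \<Gamma> D > 0"
      by simp
    \<comment> \<open>The normalized package competes in the infimum; scaling back by the distance
      recovers \<open>M D\<close>.\<close>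
    have "D /\<^sub>R gauge_dist N \<Gamma> D \<in> unit_quotient_sphere A N \<Gamma>"
      using normalization[OF D r] by (simp add: unit_quotient_sphere_def)
    then have "tax_gap A N \<Gamma> M \<le> M (D /\<^sub>R gauge_dist N \<Gamma> D)"
      unfolding tax_gap_def by (rule INF_lower)
    then have "ereal (gauge_dist N \<Gamma> D) * tax_gap A N \<Gamma> M
        \<le> ereal (gauge_dist N \<Gamma> D) * M (D /\<^sub>R gauge_dist N \<Gamma> D)"
      using r by (intro ereal_mult_left_mono) auto
    also have "\<dots> = M D"
      using homogeneous[OF D r] by simp
    finally show ?thesis
      by (simp add: mult.commute)
  qed
  with gap_pos show ?thesis
    by blast
qed

end
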